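(* If $G$ is a finite simple undirected graph that is $(P_6,\text{HHD})$-free and has an efficient dominating set, then its square $G^2$ is chordal.
   Context: All graphs are finite, undirected and simple. A vertex dominates itself and its neighbors. A set $D\subseteq V$ is an efficient dominating set (e.d.) of $G=(V,E)$ if every vertex of $G$ is dominated by exactly one vertex of $D$. The square $G^2=(V,E^2)$ has $uv\in E^2$ iff $d_G(u,v)\in\{1,2\}$. "$F$-free" means containing no induced subgraph isomorphic to $F$. $P_k$ (resp. $C_k$) is the chordless path (resp. cycle) on $k$ vertices. A hole is a $C_k$ with $k\ge 5$. The house is the complement of $P_5$. The domino is the graph on six vertices obtained from a $P_5$ $x_1,\ldots,x_5$ by adding a vertex $y$ adjacent exactly to $x_1,x_3,x_5$. A graph is HHD-free if it has no induced house, hole or domino; $(P_6,\text{HHD})$-free means HHD-free and $P_6$-free. A graph is chordal if it is $C_k$-free for every $k\ge 4$. *)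

theory Defs
  imports "Graph_Theory.Graph_Theory"
begin

text \<open>
  A finite simple undirected graph is a value \<open>G\<close> satisfying \<^locale>\<open>pair_graph\<close>: an undirected
  edge \<open>uv\<close> is represented by the two arcs \<open>(u, v)\<close> and \<open>(v, u)\<close>. The empty graph is included.
\<close>

definition complement_graph :: "'a pair_pre_digraph \<Rightarrow> 'a pair_pre_digraph" where
  "complement_graph G =
    \<lparr> pverts = pverts G,
      parcs = {(u, v). u \<in> pverts G \<and> v \<in> pverts G \<and> u \<noteq> v \<and> (u, v) \<notin> parcs G} \<rparr>"

text \<open>\<open>P\<^sub>k\<close> and \<open>C\<^sub>k\<close>, counted by vertices. The latter is a simple cycle only for \<open>k \<ge> 3\<close>.\<close>

definition path_graph :: "nat \<Rightarrow> nat pair_pre_digraph" where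
  "path_graph k =
    \<lparr> pverts = {..<k},
      parcs = {(i, j). i < k \<and> j < k \<and> (j = Suc i \<or> i = Suc j)} \<rparr>"

definition cycle_graph :: "nat \<Rightarrow> nat pair_pre_digraph" where
  "cycle_graph k =
    \<lparr> pverts = {..<k},
      parcs = {(i, j). i < k \<and> j < k \<and> (j = Suc i mod k \<or> i = Suc j mod k)} \<rparr>"

definition house :: "nat pair_pre_digraph" where
  "house = complement_graph (path_graph 5)"

text \<open>The path \<open>x\<^sub>1, \<dots>, x\<^sub>5\<close> is \<open>0, \<dots>, 4\<close>, and \<open>y\<close> is \<open>5\<close>.\<close>

definition domino :: "nat pair_pre_digraph" where
  "domino =
    \<lparr> pverts = insert 5 (pverts (path_graph 5)),
      parcs = parcs (path_graph 5) \<union> {5} \<times> {0, 2, 4} \<union> {0, 2, 4} \<times> {5} \<rparr>"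

definition induced_free :: "'b pair_pre_digraph \<Rightarrow> 'a pair_pre_digraph \<Rightarrow> bool" where
  "induced_free F G \<longleftrightarrow>
    \<not> (\<exists>H. induced_subgraph H (with_proj G) \<and> digraph_iso (with_proj F) H)"

definition HHD_free :: "'a pair_pre_digraph \<Rightarrow> bool" where
  "HHD_free G \<longleftrightarrow>
    induced_free house G \<and> (\<forall>k\<ge>5. induced_free (cycle_graph k) G) \<and> induced_free domino G"

definition chordal :: "'a pair_pre_digraph \<Rightarrow> bool" where
  "chordal G \<longleftrightarrow> (\<forall>k\<ge>4. induced_free (cycle_graph k) G)"

text \<open>Domination is reflexive, unlike the library's \<^const>\<open>dominates\<close>, which is adjacency.\<close>

definition vertex_dominates :: "'a pair_pre_digraph \<Rightarrow> 'a \<Rightarrow> 'a \<Rightarrow> bool" where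
  "vertex_dominates G u v \<longleftrightarrow> u = v \<or> (u, v) \<in> parcs G"

definition efficient_dominating_set :: "'a pair_pre_digraph \<Rightarrow> 'a set \<Rightarrow> bool" where
  "efficient_dominating_set G D \<longleftrightarrow>
    D \<subseteq> pverts G \<and> (\<forall>v\<in>pverts G. \<exists>!d. d \<in> D \<and> vertex_dominates G d v)"

text \<open>Unit arc weights give the usual distance, with value \<open>\<infinity>\<close> between different components.\<close>

definition graph_dist :: "'a pair_pre_digraph \<Rightarrow> 'a \<Rightarrow> 'a \<Rightarrow> ereal" where
  "graph_dist G u v = wf_digraph.\<mu> (with_proj G) (\<lambda>_. 1) u v"

definition square_graph :: "'a pair_pre_digraph \<Rightarrow> 'a pair_pre_digraph" where
  "square_graph G =
    \<lparr> pverts = pverts G,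
      parcs = {(u, v). u \<in> pverts G \<and> v \<in> pverts G \<and> graph_dist G u v \<in> {1, 2}} \<rparr>"

end

theory Submission
  imports Defs
begin

text \<open>
  Suppose that \<open>G\<^sup>2\<close> has an induced cycle \<open>v\<^sub>0, \<dots>, v\<^bsub>k-1\<^esub>\<close> with \<open>k \<ge> 4\<close>. HHD-freeness forces consecutive
  \<open>v\<^sub>i\<close> to be nonadjacent in \<open>G\<close>, and any common neighbours \<open>y\<close> of \<open>v\<^bsub>i-1\<^esub>, v\<^sub>i\<close> and \<open>z\<close> of \<open>v\<^sub>i, v\<^bsub>i+1\<^esub>\<close> to be
  adjacent: otherwise the closed walk around the cycle contains a house, a hole or a domino. Choose a
  common neighbour \<open>x\<^sub>i\<close> of each pair \<open>v\<^sub>i, v\<^bsub>i+1\<^esub>\<close>.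

  If some \<open>v\<^sub>i\<close> belonged to the efficient dominating set, or some dominator saw two consecutive \<open>v\<^sub>i\<close>, then
  the dominators of the next vertices on both sides would be the ends of a \<open>P\<^sub>6\<close>. So each \<open>v\<^sub>i\<close> has a private
  dominator \<open>p\<^sub>i\<close>. The path \<open>p\<^sub>i v\<^sub>i x\<^sub>i x\<^bsub>i+1\<^esub> v\<^bsub>i+2\<^esub> p\<^bsub>i+2\<^esub>\<close> is not induced, and since an \<open>x\<^sub>i\<close> has only one dominator,
  this propagates around the cycle: either \<open>p\<^sub>i \<sim> x\<^sub>i\<close> for all \<open>i\<close>, or \<open>p\<^bsub>i+1\<^esub> \<sim> x\<^sub>i\<close> for all \<open>i\<close>. Now every chord of
  the cycle \<open>x\<^sub>0, \<dots>, x\<^bsub>k-1\<^esub>\<close> yields a \<open>P\<^sub>6\<close>, so that cycle is a hole, or for \<open>k = 4\<close> a house together with \<open>v\<^sub>1\<close>.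
\<close>

subsection \<open>Induced subgraphs and squares\<close>

text \<open>To be compatible with \<open>with_proj G\<close>, the copy of \<open>F\<close> must have
  \<open>fst\<close> and \<open>snd\<close> as tail and head, so arcs are carried along
  \<open>map_prod f f\<close>.\<close>

lemma not_induced_freeI:
  assumes F: "pair_wf_digraph F" and G: "pair_wf_digraph G"
    and inj: "inj_on f (pverts F)" and img: "f ` pverts F \<subseteq> pverts G"
    and arcs: "\<And>i j. i \<in> pverts F \<Longrightarrow> j \<in> pverts F \<Longrightarrow> (f i, f j) \<in> parcs G \<longleftrightarrow> (i, j) \<in> parcs F"
  shows "\<not> induced_free F G"
proof -
  define h where "h = \<lparr> iso_verts = f, iso_arcs = map_prod f f, iso_head = snd, iso_tail = fst \<rparr>"
  interpret F: pair_wf_digraph F by (rule F)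
  interpret G: pair_wf_digraph G by (rule G)
  have sub: "parcs F \<subseteq> pverts F \<times> pverts F"
    using F.wellformed' by auto
  have iso: "pre_digraph.digraph_isomorphism (with_proj F) h"
    unfolding pre_digraph.digraph_isomorphism_def h_def
    using inj inj_on_subset[OF map_prod_inj_on[OF inj inj] sub]
    by (simp add: wf_digraph_wp_iff F)
  have "wf_digraph (app_iso h (with_proj F))"
    using iso by (rule F.wf_digraphI_app_iso)
  moreover have "map_prod f f ` parcs F =
      {e \<in> parcs G. fst e \<in> f ` pverts F \<and> snd e \<in> f ` pverts F}" (is "?L = ?R")
  proof
    show "?L \<subseteq> ?R" using arcs sub by force
    show "?R \<subseteq> ?L"
    proof
      fix e assume "e \<in> ?R"
      then obtain i j where ij: "e = (f i, f j)" "i \<in> pverts F" "j \<in> pverts F" "e \<in> parcs G"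
        by (cases e) auto
      then have "(i, j) \<in> parcs F" using arcs by auto
      then show "e \<in> ?L" using ij by force
    qed
  qed
  ultimately have "induced_subgraph (app_iso h (with_proj F)) (with_proj G)"
    unfolding induced_subgraph_def subgraph_def compatible_def
    using img G by (auto simp: h_def wf_digraph_wp_iff)
  then show ?thesis
    using iso unfolding induced_free_def digraph_iso_def by blast
qed

lemma not_induced_freeE:
  assumes "\<not> induced_free F G"
  obtains f where "inj_on f (pverts F)" "f ` pverts F \<subseteq> pverts G"
    "\<And>i j. i \<in> pverts F \<Longrightarrow> j \<in> pverts F \<Longrightarrow> (f i, f j) \<in> parcs G \<longleftrightarrow> (i, j) \<in> parcs F"
proof -
  obtain h where iso: "pre_digraph.digraph_isomorphism (with_proj F) h"
    and ind: "induced_subgraph (app_iso h (with_proj F)) (with_proj G)"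
    using assms unfolding induced_free_def digraph_iso_def by blast
  have wf: "pair_wf_digraph F"
    using iso unfolding pre_digraph.digraph_isomorphism_def by (simp add: wf_digraph_wp_iff)
  interpret F: pair_wf_digraph F by (rule wf)
  define f where "f = iso_verts h"
  have inj: "inj_on f (pverts F)"
    using iso unfolding pre_digraph.digraph_isomorphism_def f_def by simp
  \<comment> \<open>Compatibility with \<open>with_proj G\<close> fixes tail and head as the
    projections, so the vertex map determines the arc map.\<close>
  have ht: "iso_tail h = fst" "iso_head h = snd"
    using ind unfolding induced_subgraph_def subgraph_def compatible_def by auto
  have a: "iso_arcs h (i, j) = (f i, f j)" if "(i, j) \<in> parcs F" for i j
    using iso that unfolding pre_digraph.digraph_isomorphism_def f_def ht
    by (simp add: prod_eq_iff) (metis fst_conv snd_conv)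
  have arcs: "iso_arcs h ` parcs F = {e \<in> parcs G. fst e \<in> f ` pverts F \<and> snd e \<in> f ` pverts F}"
    and img: "f ` pverts F \<subseteq> pverts G"
    using ind unfolding induced_subgraph_def subgraph_def f_def by auto
  have "(f i, f j) \<in> parcs G \<longleftrightarrow> (i, j) \<in> parcs F" if ij: "i \<in> pverts F" "j \<in> pverts F" for i j
  proof
    assume "(i, j) \<in> parcs F"
    then have "(f i, f j) \<in> iso_arcs h ` parcs F" using a by force
    then show "(f i, f j) \<in> parcs G" using arcs by auto
  next
    assume "(f i, f j) \<in> parcs G"
    then have "(f i, f j) \<in> iso_arcs h ` parcs F" using arcs ij by auto
    then obtain i' j' where e: "(i', j') \<in> parcs F" "(f i, f j) = (f i', f j')"
      using a by (metis (no_types, lifting) imageE surj_pair)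
    then have "i' = i" "j' = j"
      using inj ij F.wellformed' by (auto dest: inj_onD)
    then show "(i, j) \<in> parcs F" using e by simp
  qed
  then show ?thesis using that inj img by blast
qed

lemma pair_wf_digraph_path_graph: "pair_wf_digraph (path_graph n)"
  by unfold_locales (auto simp: path_graph_def)

lemma pair_wf_digraph_cycle_graph: "pair_wf_digraph (cycle_graph n)"
  by unfold_locales (auto simp: cycle_graph_def)

lemma pair_wf_digraph_house: "pair_wf_digraph house"
  by unfold_locales (auto simp: house_def complement_graph_def)

lemma pair_wf_digraph_domino: "pair_wf_digraph domino"
  by unfold_locales (auto simp: domino_def path_graph_def)

lemma graph_dist_1_2_iff:
  assumes "pair_graph G"
  shows "graph_dist G u v \<in> {1, 2} \<longleftrightarrow>
    u \<noteq> v \<and> ((u, v) \<in> parcs G \<or> (\<exists>x. (u, x) \<in> parcs G \<and> (x, v) \<in> parcs G)) \<and>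
    u \<in> pverts G \<and> v \<in> pverts G"
proof -
  interpret pair_graph G by (rule assms)
  have cost: "awalk_cost (\<lambda>_. 1) p = real (length p)" for p :: "('a \<times> 'a) list"
    by (induction p) auto
  have dist: "graph_dist G u v = (INF p\<in>{p. awalk u p v}. ereal (real (length p)))"
    unfolding graph_dist_def \<mu>_def cost ..
  have bound: "graph_dist G u v \<le> real (length p)" if "awalk u p v" for p
    unfolding dist using that by (auto intro!: INF_lower2[of p])
  show ?thesis
  proof
    assume d: "graph_dist G u v \<in> {1, 2}"
    \<comment> \<open>An infimum that fails the lower bound 3 has a walk of length below 3 among its
      terms.\<close>
    then have "\<not> 3 \<le> graph_dist G u v" by auto
    then obtain p where p: "awalk u p v" "\<not> 3 \<le> ereal (real (length p))"
      unfolding dist by (auto simp: le_INF_iff)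
    have uv: "u \<in> pverts G" "v \<in> pverts G"
      using reachable_in_verts[OF reachable_awalkI[OF p(1)]] by auto
    have "u \<noteq> v"
    proof
      assume "u = v"
      then have "awalk u [] v" using uv by (simp add: awalk_Nil_iff)
      then have "graph_dist G u v \<le> 0" using bound[of "[]"] by (simp add: zero_ereal_def)
      then show False using d by auto
    qed
    have "length p < 3" using p(2) by (simp add: numeral_eq_ereal)
    then have "p = [] \<or> (\<exists>a. p = [a]) \<or> (\<exists>a b. p = [a, b])"
      by (cases p; cases "tl p"; cases "tl (tl p)") auto
    then show "u \<noteq> v \<and> ((u, v) \<in> parcs G \<or> (\<exists>x. (u, x) \<in> parcs G \<and> (x, v) \<in> parcs G)) \<and>
      u \<in> pverts G \<and> v \<in> pverts G"
      using p(1) \<open>u \<noteq> v\<close> uv by (auto simp: awalk_Cons_iff awalk_Nil_iff)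
  next
    assume R: "u \<noteq> v \<and> ((u, v) \<in> parcs G \<or> (\<exists>x. (u, x) \<in> parcs G \<and> (x, v) \<in> parcs G)) \<and>
      u \<in> pverts G \<and> v \<in> pverts G"
    have len: "length p \<ge> 1" if "awalk u p v" for p
      using that R by (cases p) (auto simp: awalk_Nil_iff)
    show "graph_dist G u v \<in> {1, 2}"
    proof (cases "(u, v) \<in> parcs G")
      case True
      then have "awalk u [(u, v)] v" using R by (auto simp: awalk_Cons_iff awalk_Nil_iff)
      then have "graph_dist G u v \<le> 1" using bound[of "[(u, v)]"] by (simp add: one_ereal_def)
      moreover have "1 \<le> graph_dist G u v"
        unfolding dist using len by (intro INF_greatest) (auto simp: one_ereal_def)
      ultimately show ?thesis by auto
    next
      case False
      then obtain x where x: "(u, x) \<in> parcs G" "(x, v) \<in> parcs G" using R by auto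
      then have "awalk u [(u, x), (x, v)] v" using R wellformed'
        by (auto simp: awalk_Cons_iff awalk_Nil_iff)
      then have "graph_dist G u v \<le> 2" using bound[of "[(u, x), (x, v)]"] by (simp add: numeral_eq_ereal)
      moreover have "length p \<ge> 2" if "awalk u p v" for p
        using that R False by (cases p; cases "tl p") (auto simp: awalk_Nil_iff awalk_Cons_iff)
      then have "2 \<le> graph_dist G u v"
        unfolding dist by (intro INF_greatest) (auto simp: numeral_eq_ereal)
      ultimately show ?thesis by auto
    qed
  qed
qed

subsection \<open>Walks around an edge\<close>

text \<open>In a walk with the fewest steps a repeated vertex or a chord would be a shortcut. A
  general \<open>R\<close> allows adjacency to be restricted to a vertex set or stripped of an
  edge.\<close>

lemma shortest_walk_induced:
  assumes sym: "symp R" and irr: "irreflp R" and reach: "R\<^sup>*\<^sup>* u w"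
  obtains f :: "nat \<Rightarrow> 'a" and n where "f 0 = u" "f n = w"
    "\<And>i j. i \<le> n \<Longrightarrow> j \<le> n \<Longrightarrow> R (f i) (f j) \<longleftrightarrow> j = Suc i \<or> i = Suc j"
    "inj_on f {..n}"
proof -
  define n where "n = (LEAST n. (R ^^ n) u w)"
  have n: "(R ^^ n) u w"
    unfolding n_def using reach by (metis LeastI_ex rtranclp_imp_relpowp)
  have min: "n \<le> m" if "(R ^^ m) u w" for m
    unfolding n_def using that by (rule Least_le)
  obtain f where f: "f 0 = u" "f n = w" "\<And>i. i < n \<Longrightarrow> R (f i) (f (Suc i))"
    using n unfolding relpowp_fun_conv by auto
  have pre: "(R ^^ i) u (f i)" if "i \<le> n" for i
    unfolding relpowp_fun_conv using f that by (intro exI[of _ f]) auto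
  have post: "(R ^^ (n - i)) (f i) w" if "i \<le> n" for i
    unfolding relpowp_fun_conv using f that by (intro exI[of _ "\<lambda>j. f (i + j)"]) auto
  have short: "j - i \<le> m" if "i \<le> j" "j \<le> n" "(R ^^ m) (f i) (f j)" for i j m
  proof -
    have "(R ^^ (i + m + (n - j))) u w"
      unfolding relpowp_add using pre[of i] post[of j] that by (auto intro!: relcomppI)
    from min[OF this] show ?thesis using that by simp
  qed
  have inj: "inj_on f {..n}"
  proof (rule linorder_inj_onI')
    fix i j assume "i \<in> {..n}" "j \<in> {..n}" "i < j"
    then show "f i \<noteq> f j" using short[of i j 0] by auto
  qed
  have *: "R (f i) (f j) \<longleftrightarrow> j = Suc i" if "i \<le> j" "j \<le> n" for i j
  proof
    assume r: "R (f i) (f j)"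
    then have "i \<noteq> j" using irr by (auto dest: irreflpD)
    moreover have "(R ^^ 1) (f i) (f j)" using r by (simp only: relpowp_1)
    ultimately show "j = Suc i" using short[of i j 1] that by simp
  qed (use f that in auto)
  have "R (f i) (f j) \<longleftrightarrow> j = Suc i \<or> i = Suc j" if "i \<le> n" "j \<le> n" for i j
    using *[of i j] *[of j i] that sympD[OF sym, of "f i" "f j"] sympD[OF sym, of "f j" "f i"]
    by (cases "i \<le> j") auto
  then show ?thesis using that f inj by blast
qed

text \<open>In \<open>no_house\<close>, \<open>r\<close> is the roof over the edge
  \<open>a b\<close> of the four-cycle \<open>a b c d\<close>. In \<open>no_domino\<close>, the
  four-cycles \<open>a b c d\<close> and \<open>c e f d\<close> share the edge \<open>c d\<close>.
  The adjacencies themselves force the vertices to be distinct.\<close>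

locale hhd_free_adjacency =
  fixes A :: "'a \<Rightarrow> 'a \<Rightarrow> bool"  (infix \<open>\<sim>\<close> 50)
  assumes adj_sym: "a \<sim> b \<Longrightarrow> b \<sim> a"
    and adj_irrefl: "\<not> a \<sim> a"
    and no_house: "\<lbrakk>a \<sim> b; b \<sim> c; c \<sim> d; d \<sim> a; \<not> a \<sim> c; \<not> b \<sim> d;
      r \<sim> a; r \<sim> b; \<not> r \<sim> c; \<not> r \<sim> d\<rbrakk> \<Longrightarrow> False"
    and no_domino: "\<lbrakk>a \<sim> b; b \<sim> c; c \<sim> d; d \<sim> a; \<not> a \<sim> c; \<not> b \<sim> d;
      c \<sim> e; e \<sim> f; f \<sim> d; \<not> c \<sim> f; \<not> e \<sim> d; \<not> a \<sim> e; \<not> a \<sim> f; \<not> b \<sim> e; \<not> b \<sim> f\<rbrakk> \<Longrightarrow> False"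
    and no_hole: "5 \<le> n \<Longrightarrow>
      (\<And>i j. i < n \<Longrightarrow> j < n \<Longrightarrow> g i \<sim> g j \<longleftrightarrow> j = Suc i mod n \<or> i = Suc j mod n) \<Longrightarrow> False"
begin

lemma adj_neq: "a \<sim> b \<Longrightarrow> a \<noteq> b"
  using adj_irrefl by blast

text \<open>The hole is given as a path whose ends are joined; \<open>n\<close> is the last index,
  so there are \<open>n + 1\<close> vertices.\<close>

lemma no_hole_path:
  assumes "4 \<le> n"
    and adj: "\<And>i j. i \<le> n \<Longrightarrow> j \<le> n \<Longrightarrow> f i \<sim> f j \<longleftrightarrow>
      j = Suc i \<or> i = Suc j \<or> (i = 0 \<and> j = n) \<or> (i = n \<and> j = 0)"
  shows False
proof (rule no_hole[of "Suc n" f])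
  fix i j assume "i < Suc n" "j < Suc n"
  then show "f i \<sim> f j \<longleftrightarrow> j = Suc i mod Suc n \<or> i = Suc j mod Suc n"
    using adj[of i j] assms(1) by (cases "i = n"; cases "j = n") (auto simp: mod_less)
qed (use assms in auto)

lemma reach_along:
  fixes s :: "nat \<Rightarrow> 'a"
  assumes "\<And>j. j < n \<Longrightarrow> s j = s (Suc j) \<or> R (s j) (s (Suc j))"
  shows "R\<^sup>*\<^sup>* (s 0) (s n)"
  using assms
proof (induction n)
  case (Suc n)
  then have "R\<^sup>*\<^sup>* (s 0) (s n)" by simp
  moreover have "s n = s (Suc n) \<or> R (s n) (s (Suc n))" using Suc.prems[of n] by simp
  ultimately show ?case by auto
qed simp

text \<open>
  The first shortest path closes up to a hole through \<open>a\<close> and \<open>b\<close> unless \<open>s 0 \<sim> s n\<close>. Then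
  \<open>a, s 0, s n, b\<close> is a 4-cycle, and a shortest path that avoids the edge between \<open>s 0\<close> and \<open>s n\<close>
  gives a house, a domino or a hole.
\<close>

lemma no_walk_around_edge:
  fixes s :: "nat \<Rightarrow> 'a"
  assumes n: "2 \<le> n" and ab: "a \<sim> b"
    and step: "\<And>j. j < n \<Longrightarrow> s j = s (Suc j) \<or> s j \<sim> s (Suc j)"
    and a: "\<And>j. j \<le> n \<Longrightarrow> a \<sim> s j \<longleftrightarrow> j = 0"
    and b: "\<And>j. j \<le> n \<Longrightarrow> b \<sim> s j \<longleftrightarrow> j = n"
  shows False
proof -
  define S where "S = s ` {..n}"
  have aS: "a \<sim> y \<longleftrightarrow> y = s 0" and bS: "b \<sim> y \<longleftrightarrow> y = s n" if "y \<in> S" for y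
    using that a b n unfolding S_def by (auto; metis le0)+
  have neq: "s 0 \<noteq> s n"
    using a[of 0] a[of n] n by auto
  have path: "\<exists>f m. f 0 = s 0 \<and> f m = s n \<and>
      (\<forall>i\<le>m. \<forall>j\<le>m. R (f i) (f j) \<longleftrightarrow> j = Suc i \<or> i = Suc j) \<and> inj_on f {..m} \<and> f ` {..m} \<subseteq> S \<and> 1 \<le> m"
    if R: "R = (\<lambda>x y. x \<in> S \<and> y \<in> S \<and> x \<sim> y \<and> P x y)" and P: "\<And>x y. P x y \<longleftrightarrow> P y x"
      and sP: "\<And>j. j < n \<Longrightarrow> s j \<noteq> s (Suc j) \<Longrightarrow> P (s j) (s (Suc j))" for R P
  proof -
    have "R\<^sup>*\<^sup>* (s 0) (s n)"
    proof (rule reach_along)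
      fix j assume "j < n"
      then show "s j = s (Suc j) \<or> R (s j) (s (Suc j))"
        using step[of j] sP[of j] unfolding R S_def by auto
    qed
    moreover have "symp R" unfolding R by (rule sympI) (use P adj_sym in blast)
    moreover have "irreflp R" unfolding R by (rule irreflpI) (use adj_irrefl in blast)
    ultimately obtain f m where f: "f 0 = s 0" "f m = s n" "inj_on f {..m}"
        "\<And>i j. i \<le> m \<Longrightarrow> j \<le> m \<Longrightarrow> R (f i) (f j) \<longleftrightarrow> j = Suc i \<or> i = Suc j"
      using shortest_walk_induced by metis
    have m: "1 \<le> m" using f(1,2) neq by (cases m) auto
    have "f i \<in> S" if "i \<le> m" for i
    proof (cases "i = m")
      case True then show ?thesis using f(2) by (auto simp: S_def)
    next
      case False then show ?thesis using f(4)[of i "Suc i"] that by (simp add: R)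
    qed
    then show ?thesis using f m by (intro exI[of _ f] exI[of _ m]) auto
  qed
  \<comment> \<open>On the walk \<open>b\<close> sees only \<open>s n\<close>, so \<open>a\<close>
    could only be \<open>s n\<close>; then \<open>s (n - 1)\<close> would be a forbidden neighbour
    of \<open>a\<close> or \<open>b\<close>, as \<open>n\<close> is at least 2.\<close>
  have a_notin: "a \<notin> S"
  proof
    assume "a \<in> S"
    then obtain j where j: "j \<le> n" "a = s j" unfolding S_def by auto
    then have "j = n" using b[of j] ab adj_sym by auto
    then have "s (n - 1) = s n \<or> s (n - 1) \<sim> s n" using step[of "n - 1"] n by auto
    then show False
      using b[of "n - 1"] b[of n] a[of "n - 1"] n j \<open>j = n\<close> adj_sym by auto
  qed
  have b_notin: "b \<notin> S"
  proof
    assume "b \<in> S"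
    then obtain j where j: "j \<le> n" "b = s j" unfolding S_def by auto
    then have "j = 0" using a[of j] ab by auto
    then have "s 0 = s 1 \<or> s 0 \<sim> s 1" using step[of 0] n by auto
    then show False
      using a[of 0] a[of 1] b[of 1] n j \<open>j = 0\<close> by auto
  qed
  have close: "s 0 \<sim> s n"
  proof (rule ccontr)
    assume no: "\<not> s 0 \<sim> s n"
    obtain f m where f: "f 0 = s 0" "f m = s n" "inj_on f {..m}" "f ` {..m} \<subseteq> S" "1 \<le> m"
        "\<And>i j. i \<le> m \<Longrightarrow> j \<le> m \<Longrightarrow> f i \<in> S \<and> f j \<in> S \<and> f i \<sim> f j \<longleftrightarrow> j = Suc i \<or> i = Suc j"
      using path[of "\<lambda>x y. x \<in> S \<and> y \<in> S \<and> x \<sim> y \<and> True" "\<lambda>_ _. True"] by auto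
    have m: "2 \<le> m" using f(6)[of 0 1] f(1,2,5) no by (cases "m = 1") auto
    \<comment> \<open>The hole is \<open>a, f 0, ..., f m, b\<close>, with last index
      \<open>m + 2\<close>.\<close>
    define g where "g = (\<lambda>i. if i = 0 then a else if i = m + 2 then b else f (i - 1))"
    have fS: "f i \<in> S" if "i \<le> m" for i using f(4) that by auto
    have f0: "f i = s 0 \<longleftrightarrow> i = 0" and fm: "f i = s n \<longleftrightarrow> i = m" if "i \<le> m" for i
      using inj_on_eq_iff[OF f(3), of i 0] inj_on_eq_iff[OF f(3), of i m] f(1,2) that by auto
    have mid: "f i \<sim> f j \<longleftrightarrow> j = Suc i \<or> i = Suc j" if "i \<le> m" "j \<le> m" for i j
      using f(6)[OF that] fS that by auto
    have af: "a \<sim> f i \<longleftrightarrow> i = 0" "f i \<sim> a \<longleftrightarrow> i = 0" and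
         bf: "b \<sim> f i \<longleftrightarrow> i = m" "f i \<sim> b \<longleftrightarrow> i = m" if "i \<le> m" for i
      using aS[OF fS[OF that]] bS[OF fS[OF that]] f0[OF that] fm[OF that] adj_sym by blast+
    show False
    proof (rule no_hole_path[of "m + 2" g])
      fix i j assume ij: "i \<le> m + 2" "j \<le> m + 2"
      have split: "i = 0 \<or> i = m + 2 \<or> (\<exists>i'\<le>m. i = Suc i')" if "i \<le> m + 2" for i
        using that by (cases i) (auto simp: le_Suc_eq)
      show "g i \<sim> g j \<longleftrightarrow>
          j = Suc i \<or> i = Suc j \<or> (i = 0 \<and> j = m + 2) \<or> (i = m + 2 \<and> j = 0)"
        using split[OF ij(1)] split[OF ij(2)] ab adj_sym[OF ab] m
        by (elim disjE exE conjE) (simp_all add: g_def af bf mid adj_irrefl, auto)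
    qed (use m in auto)
  qed
  \<comment> \<open>\<open>P\<close> deletes the edge between \<open>s 0\<close> and
    \<open>s n\<close>. The walk itself never uses it: only index 0 is next to \<open>a\<close>,
    only index \<open>n\<close> is next to \<open>b\<close>, and these are not successive.\<close>
  define P where "P = (\<lambda>x y. {x, y} \<noteq> {s 0, s n})"
  have "P (s j) (s (Suc j))" if "j < n" for j
    unfolding P_def
  proof
    assume "{s j, s (Suc j)} = {s 0, s n}"
    then have "s (Suc j) = s 0 \<or> s j = s 0 \<and> s (Suc j) = s n" by (auto simp: doubleton_eq_iff)
    then show False
      using a[of 0] a[of "Suc j"] a[of j] b[of n] b[of "Suc j"] that n by auto
  qed
  then obtain f m where f: "f 0 = s 0" "f m = s n" "inj_on f {..m}" "f ` {..m} \<subseteq> S" "1 \<le> m"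
      "\<And>i j. i \<le> m \<Longrightarrow> j \<le> m \<Longrightarrow>
        f i \<in> S \<and> f j \<in> S \<and> f i \<sim> f j \<and> P (f i) (f j) \<longleftrightarrow> j = Suc i \<or> i = Suc j"
    using path[of "\<lambda>x y. x \<in> S \<and> y \<in> S \<and> x \<sim> y \<and> P x y" P]
    by (auto simp: P_def insert_commute)
  have fS: "f i \<in> S" if "i \<le> m" for i using f(4) that by auto
  have m: "2 \<le> m" using f(6)[of 0 1] f(1,2,5) by (cases "m = 1") (auto simp: P_def)
  have f0: "f i = s 0 \<longleftrightarrow> i = 0" and fm: "f i = s n \<longleftrightarrow> i = m" if "i \<le> m" for i
    using inj_on_eq_iff[OF f(3), of i 0] inj_on_eq_iff[OF f(3), of i m] f(1,2) that by auto
  have mid: "f i \<sim> f j \<longleftrightarrow> j = Suc i \<or> i = Suc j \<or> (i = 0 \<and> j = m) \<or> (i = m \<and> j = 0)"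
    if "i \<le> m" "j \<le> m" for i j
  proof (cases "P (f i) (f j)")
    case True
    then have "\<not> (i = 0 \<and> j = m)" "\<not> (i = m \<and> j = 0)" using f(1,2) by (auto simp: P_def insert_commute)
    then show ?thesis using True f(6)[OF that] fS that by auto
  next
    case False
    then have "i = 0 \<and> j = m \<or> i = m \<and> j = 0"
      using f0[OF that(1)] fm[OF that(1)] f0[OF that(2)] fm[OF that(2)]
      by (auto simp: P_def doubleton_eq_iff)
    then show ?thesis using close f(1,2) adj_sym by auto
  qed
  have af: "a \<sim> f i \<longleftrightarrow> i = 0" "f i \<sim> a \<longleftrightarrow> i = 0" and
       bf: "b \<sim> f i \<longleftrightarrow> i = m" "f i \<sim> b \<longleftrightarrow> i = m" if "i \<le> m" for i
    using aS[OF fS[OF that]] bS[OF fS[OF that]] f0[OF that] fm[OF that] adj_sym by blast+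
  \<comment> \<open>With the deleted edge restored, the new path closes to a chordless cycle on
    \<open>m + 1\<close> vertices: a triangle is a roof on the four-cycle through \<open>a\<close>
    and \<open>b\<close>, a four-cycle completes a domino, a longer cycle is a hole.\<close>
  consider "m = 2" | "m = 3" | "4 \<le> m" using m by linarith
  then show False
  proof cases
    case 1
    show False
      by (rule no_house[of "f 0" "f 2" b a "f 1"])
        (use 1 ab adj_sym[OF ab] in \<open>auto simp: af bf mid\<close>)
  next
    case 2
    show False
      by (rule no_domino[of a b "f 3" "f 0" "f 2" "f 1"])
        (use 2 ab adj_sym[OF ab] in \<open>auto simp: af bf mid\<close>)
  next
    case 3
    show False
      by (rule no_hole_path[OF 3, of f]) (rule mid)
  qed
qed

end

subsection \<open>Induced cycles in the square\<close>

text \<open>Indices run over the integers and are read modulo \<open>k\<close>, so that \<open>i - 1\<close> and \<open>i + 1\<close> never need wrapping.\<close>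

locale square_cycle = hhd_free_adjacency +
  fixes v :: "int \<Rightarrow> 'a" and k :: int
  assumes k4: "4 \<le> k"
    and v_eq_iff: "v i = v j \<longleftrightarrow> k dvd i - j"
    and square_adj_iff: "v i \<noteq> v j \<Longrightarrow>
      v i \<sim> v j \<or> (\<exists>x. v i \<sim> x \<and> x \<sim> v j) \<longleftrightarrow> k dvd i - j - 1 \<or> k dvd i - j + 1"
begin

section \<open>Arithmetic modulo \<open>k\<close> and the neighbours of cycle vertices\<close>

lemma dvd_small: "k dvd m \<Longrightarrow> - k < m \<Longrightarrow> m < k \<Longrightarrow> m = 0"
  using zdvd_not_zless[of m k] zdvd_not_zless[of "- m" k] by fastforce

lemma dvd_neg: "k dvd m \<Longrightarrow> - k \<le> m \<Longrightarrow> m < 0 \<Longrightarrow> m = - k"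
  using dvd_small[of m] by fastforce

lemma not_dvd_const [simp]:
  "\<not> k dvd 1" "\<not> k dvd 2" "\<not> k dvd 3" "\<not> k dvd - 1" "\<not> k dvd - 2" "\<not> k dvd - 3" "\<bar>k\<bar> \<noteq> 1"
  using k4 dvd_small[of 1] dvd_small[of 2] dvd_small[of 3] by auto

lemma dvd_adjacent:
  assumes "v i \<sim> v j"
  shows "k dvd i - j - 1 \<or> k dvd i - j + 1"
  using square_adj_iff[of i j] assms adj_neq[OF assms] by blast

lemma dvd_common_neighbour:
  assumes "x \<sim> v i" "x \<sim> v j" "\<not> k dvd i - j"
  shows "k dvd i - j - 1 \<or> k dvd i - j + 1"
  using square_adj_iff[of i j] assms v_eq_iff adj_sym by blast

lemma consecutive_close: "v i \<sim> v (i + 1) \<or> (\<exists>x. x \<sim> v i \<and> x \<sim> v (i + 1))"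
  using square_adj_iff[of i "i + 1"] v_eq_iff[of i "i + 1"] adj_sym by auto

text \<open>A third cycle vertex next to \<open>x\<close> would form a triangle with
  \<open>v i\<close> and \<open>v (i + 1)\<close> in the square, which would make \<open>k\<close>
  divide 3.\<close>

lemma connector_adj_iff:
  assumes x: "x \<sim> v i" "x \<sim> v (i + 1)"
  shows "x \<sim> v j \<longleftrightarrow> k dvd j - i \<or> k dvd j - (i + 1)"
proof
  show "x \<sim> v j" if "k dvd j - i \<or> k dvd j - (i + 1)"
    using that v_eq_iff[of j i] v_eq_iff[of j "i + 1"] x by auto
next
  assume "x \<sim> v j"
  show "k dvd j - i \<or> k dvd j - (i + 1)"
  proof (rule ccontr)
    assume no: "\<not> (k dvd j - i \<or> k dvd j - (i + 1))"
    then have "k dvd j - i - 1 \<or> k dvd j - i + 1"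
      using dvd_common_neighbour \<open>x \<sim> v j\<close> x by blast
    moreover have "k dvd j - (i + 1) - 1 \<or> k dvd j - (i + 1) + 1"
      using no dvd_common_neighbour \<open>x \<sim> v j\<close> x by blast
    ultimately have "k dvd j - i + 1" "k dvd j - i - 2"
      using no by (auto simp: algebra_simps)
    from dvd_diff[OF this] show False by simp
  qed
qed

text \<open>Otherwise \<open>v i\<close> is a common neighbour of two cycle vertices whose indices
  differ by 2.\<close>

lemma no_two_edges: "\<not> (v (i - 1) \<sim> v i \<and> v i \<sim> v (i + 1))"
  using dvd_common_neighbour[of "v i" "i - 1" "i + 1"] adj_sym by auto

text \<open>The long way round the cycle from \<open>v (i + 1)\<close> to \<open>v i\<close> is a
  walk around the supposed edge, which \<open>no_walk_around_edge\<close> forbids.\<close>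

lemma consecutive_not_adjacent: "\<not> v i \<sim> v (i + 1)"
proof
  assume e: "v i \<sim> v (i + 1)"
  then have e': "\<not> v (i - 1) \<sim> v i" "\<not> v (i + 1) \<sim> v (i + 2)"
    using no_two_edges[of i] no_two_edges[of "i + 1"] by (auto simp: add.commute)
  \<comment> \<open>Where two consecutive cycle vertices are adjacent, \<open>x j\<close> repeats
    \<open>v j\<close>, so the walk pauses there for one step.\<close>
  define x where "x j = (if v j \<sim> v (j + 1) then v j else SOME y. y \<sim> v j \<and> y \<sim> v (j + 1))" for j
  have conn: "x j \<sim> v j \<and> x j \<sim> v (j + 1)" if "\<not> v j \<sim> v (j + 1)" for j
    using someI_ex[of "\<lambda>y. y \<sim> v j \<and> y \<sim> v (j + 1)"] consecutive_close[of j] that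
    by (simp add: x_def)
  have x1: "x j = v j \<or> v j \<sim> x j" and x2: "x j \<sim> v (j + 1)" for j
    using conn[of j] adj_sym by (auto simp: x_def)
  have period: "v (j + k) = v j" for j using v_eq_iff by simp
  \<comment> \<open>The last alternative concerns \<open>v (j - 1)\<close>, which can be next to
    \<open>x j\<close> only when \<open>x j\<close> is \<open>v j\<close> itself.\<close>
  have xadj: "v m \<sim> x j \<Longrightarrow> k dvd m - j \<or> k dvd m - j - 1 \<or> k dvd m - j + 1 \<and> v j \<sim> v (j + 1)" for m j
  proof (cases "v j \<sim> v (j + 1)")
    case True
    then show "v m \<sim> x j \<Longrightarrow> k dvd m - j \<or> k dvd m - j - 1 \<or> k dvd m - j + 1 \<and> v j \<sim> v (j + 1)"
      using dvd_adjacent[of m j] by (auto simp: x_def)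
  next
    case False
    then have "x j \<sim> v m \<longleftrightarrow> k dvd m - j \<or> k dvd m - (j + 1)"
      using connector_adj_iff[of "x j" j m] conn by blast
    moreover have "m - (j + 1) = m - j - 1" by simp
    ultimately show "v m \<sim> x j \<Longrightarrow> k dvd m - j \<or> k dvd m - j - 1 \<or> k dvd m - j + 1 \<and> v j \<sim> v (j + 1)"
      using adj_sym by metis
  qed
  have xadj': "v j \<sim> v (j + 1) \<and> v m \<sim> v j" if "v m \<sim> x j" "k dvd m - j + 1" for m j
  proof -
    have "\<not> (k dvd m - j)" "\<not> (k dvd m - j - 1)"
      using dvd_diff[OF that(2), of "m - j"] dvd_diff[OF that(2), of "m - j - 1"] by auto
    then show ?thesis using xadj[OF that(1)] that(1) by (auto simp: x_def)
  qed
  \<comment> \<open>After \<open>k - 2\<close> double steps from \<open>x (i + 1)\<close> the walk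
    is at \<open>x (i + k - 1)\<close>, which is next to \<open>v (i + k) = v i\<close>.\<close>
  define n where "n = nat (2 * (k - 2))"
  define s where "s m = (if even m then x (i + 1 + int (m div 2)) else v (i + 2 + int (m div 2)))"
    for m :: nat
  have s_even: "s (2 * t) = x (i + 1 + int t)" and s_odd: "s (Suc (2 * t)) = v (i + 2 + int t)" for t
    by (auto simp: s_def)
  have cases: "(\<exists>t. m = 2 * t \<and> int t \<le> k - 2) \<or> (\<exists>t. m = Suc (2 * t) \<and> int t \<le> k - 3)"
    if "m \<le> n" for m
  proof (cases "even m")
    case True then show ?thesis using that k4 by (auto elim!: evenE simp: n_def)
  next
    case False then show ?thesis using that k4 by (auto elim!: oddE simp: n_def)
  qed
  \<comment> \<open>The delicate case is \<open>t = 1\<close>, where \<open>x (i + 2)\<close> may be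
    \<open>v (i + 2)\<close>; two successive edges would then meet at
    \<open>v (i + 1)\<close>.\<close>
  have a_x: "v (i + 1) \<sim> x (i + 1 + int t) \<longleftrightarrow> t = 0" if "int t \<le> k - 2" for t
  proof
    assume h: "v (i + 1) \<sim> x (i + 1 + int t)"
    then have "k dvd - int t \<or> k dvd - int t - 1 \<or> k dvd - int t + 1"
      using xadj[OF h] by auto
    moreover have "t = 1" if "k dvd - int t + 1"
      using dvd_small[OF that] \<open>int t \<le> k - 2\<close> k4 by auto
    moreover have "t \<noteq> 1"
      using h e' xadj'[of "i + 1" "i + 2"] by (auto simp: algebra_simps)
    ultimately show "t = 0"
      using dvd_small[of "- int t"] dvd_small[of "- int t - 1"] \<open>int t \<le> k - 2\<close> by auto
  next
    assume "t = 0"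
    then show "v (i + 1) \<sim> x (i + 1 + int t)" using conn[of "i + 1"] e' adj_sym by (simp add: add.commute)
  qed
  have b_x: "v i \<sim> x (i + 1 + int t) \<longleftrightarrow> int t = k - 2" if "int t \<le> k - 2" for t
  proof
    assume h: "v i \<sim> x (i + 1 + int t)"
    moreover have "i - (i + 1 + int t) = - int t - 1" "- int t - 1 - 1 = - int t - 2" "- int t - 1 + 1 = - int t"
      by simp_all
    ultimately have "k dvd - int t - 1 \<or> k dvd - int t - 2 \<or> k dvd - int t"
      using xadj[OF h] by metis
    moreover have "t = 0" if "k dvd - int t"
      using dvd_small[OF that] \<open>int t \<le> k - 2\<close> k4 by auto
    moreover have "t \<noteq> 0"
    proof
      assume "t = 0"
      then show False using h e' xadj'[of i "i + 1"] by (simp add: add.commute)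
    qed
    ultimately show "int t = k - 2"
      using dvd_small[of "- int t - 1"] dvd_neg[of "- int t - 2"] \<open>int t \<le> k - 2\<close> by auto
  next
    assume "int t = k - 2"
    then have "i + 1 + int t + 1 = i + k" by simp
    then show "v i \<sim> x (i + 1 + int t)"
      using x2[of "i + 1 + int t"] period[of i] adj_sym by metis
  qed
  have a_v: "\<not> v (i + 1) \<sim> v (i + 2 + int t)" if "int t \<le> k - 3" for t
  proof
    assume h: "v (i + 1) \<sim> v (i + 2 + int t)"
    moreover have "i + 1 - (i + 2 + int t) - 1 = - int t - 2" "i + 1 - (i + 2 + int t) + 1 = - int t"
      by simp_all
    ultimately have "k dvd - int t - 2 \<or> k dvd - int t"
      using dvd_adjacent[OF h] by metis
    then have "t = 0"
      using dvd_small[of "- int t - 2"] dvd_small[of "- int t"] that by auto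
    then show False using h e' by simp
  qed
  have b_v: "\<not> v i \<sim> v (i + 2 + int t)" if "int t \<le> k - 3" for t
  proof
    assume h: "v i \<sim> v (i + 2 + int t)"
    moreover have "i - (i + 2 + int t) - 1 = - int t - 3" "i - (i + 2 + int t) + 1 = - int t - 1"
      by simp_all
    ultimately have "k dvd - int t - 3 \<or> k dvd - int t - 1"
      using dvd_adjacent[OF h] by metis
    then have "i + 2 + int t = (i - 1) + k"
      using dvd_neg[of "- int t - 3"] dvd_small[of "- int t - 1"] that by auto
    then have "v (i + 2 + int t) = v (i - 1)" using period by metis
    then show False using h e' adj_sym by simp
  qed
  show False
  proof (rule no_walk_around_edge[of n "v (i + 1)" "v i" s])
    show "2 \<le> n" using k4 by (simp add: n_def)
    show "v (i + 1) \<sim> v i" using e adj_sym by blast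
    show "s m = s (Suc m) \<or> s m \<sim> s (Suc m)" for m
    proof (cases "even m")
      case True
      then obtain t where t: "m = 2 * t" by (auto elim!: evenE)
      show ?thesis unfolding t s_even s_odd using x2[of "i + 1 + int t"] by (simp add: algebra_simps)
    next
      case False
      then obtain t where t: "m = Suc (2 * t)" by (auto elim!: oddE)
      then have m: "Suc m = 2 * Suc t" by simp
      show ?thesis unfolding m s_even unfolding t s_odd
        using x1[of "i + 2 + int t"] by (auto simp: algebra_simps)
    qed
    show "v (i + 1) \<sim> s m \<longleftrightarrow> m = 0" if "m \<le> n" for m
      using cases[OF that]
    proof (elim disjE exE conjE)
      fix t assume "m = 2 * t" "int t \<le> k - 2"
      then show ?thesis using a_x[of t] by (simp only: s_even) auto
    next
      fix t assume "m = Suc (2 * t)" "int t \<le> k - 3"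
      then show ?thesis using a_v[of t] by (simp only: s_odd) auto
    qed
    show "v i \<sim> s m \<longleftrightarrow> m = n" if "m \<le> n" for m
      using cases[OF that]
    proof (elim disjE exE conjE)
      fix t assume "m = 2 * t" "int t \<le> k - 2"
      then show ?thesis using b_x[of t] k4 n_def by (simp only: s_even) auto
    next
      fix t assume "m = Suc (2 * t)" "int t \<le> k - 3"
      then show ?thesis using b_v[of t] k4 n_def by (simp only: s_odd) auto
    qed
  qed
qed

lemma v_not_adjacent: "\<not> v i \<sim> v j"
proof
  assume h: "v i \<sim> v j"
  from dvd_adjacent[OF h] show False
  proof
    assume "k dvd i - j - 1"
    then have "v i = v (j + 1)" using v_eq_iff[of i "j + 1"] by (simp add: algebra_simps)
    then show False using h consecutive_not_adjacent[of j] adj_sym by auto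
  next
    assume "k dvd i - j + 1"
    then have "v j = v (i + 1)" using v_eq_iff[of "i + 1" j] by (simp add: algebra_simps)
    then show False using h consecutive_not_adjacent[of i] by auto
  qed
qed

section \<open>Connectors of consecutive cycle vertices\<close>

definition conn :: "int \<Rightarrow> 'a" where
  "conn i = (SOME x. x \<sim> v i \<and> x \<sim> v (i + 1))"

lemma conn: "conn i \<sim> v i" "conn i \<sim> v (i + 1)"
  using someI_ex[of "\<lambda>x. x \<sim> v i \<and> x \<sim> v (i + 1)"] consecutive_close[of i] v_not_adjacent
  unfolding conn_def by auto

text \<open>The choice in \<open>conn\<close> depends only on the values \<open>v i\<close> and
  \<open>v (i + 1)\<close>, so it inherits their period.\<close>

lemma conn_cong: "k dvd i - j \<Longrightarrow> conn i = conn j"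
  using v_eq_iff[of i j] v_eq_iff[of "i + 1" "j + 1"] by (simp add: conn_def)

lemma conn_adj_iff: "conn i \<sim> v j \<longleftrightarrow> k dvd j - i \<or> k dvd j - (i + 1)"
  by (rule connector_adj_iff) (rule conn)+

text \<open>The walk \<open>s\<close> runs from \<open>z\<close> around the cycle and is cut at the first neighbour of \<open>y\<close>.\<close>

lemma connectors_adjacent:
  assumes y: "y \<sim> v (i - 1)" "y \<sim> v i" and z: "z \<sim> v i" "z \<sim> v (i + 1)"
  shows "y \<sim> z"
proof (rule ccontr)
  assume no: "\<not> y \<sim> z"
  have yadj: "y \<sim> v j \<longleftrightarrow> k dvd j - (i - 1) \<or> k dvd j - i" for j
    using connector_adj_iff[of y "i - 1" j] y by simp
  define s where "s m = (if m = 0 then z else if even m then conn (i + int (m div 2))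
    else v (i + 1 + int (m div 2)))" for m :: nat
  have s0: "s 0 = z" and s_even: "s (2 * Suc t) = conn (i + 1 + int t)"
    and s_odd: "s (Suc (2 * t)) = v (i + 1 + int t)" for t
    by (auto simp: s_def algebra_simps)
  \<comment> \<open>\<open>s N\<close> is \<open>v (i + k - 1) = v (i - 1)\<close>, a neighbour of
    \<open>y\<close>, so a first neighbour of \<open>y\<close> on the walk exists.\<close>
  define N where "N = Suc (2 * nat (k - 2))"
  define n where "n = (LEAST n. y \<sim> s n)"
  have "y \<sim> s N"
    using k4 by (simp add: N_def s_odd yadj)
  then have yn: "y \<sim> s n" and nN: "n \<le> N" and least: "\<And>m. m < n \<Longrightarrow> \<not> y \<sim> s m"
    unfolding n_def by (auto intro: LeastI Least_le dest: not_less_Least)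
  have "n \<noteq> 0" using yn no s0 by metis
  moreover have "n \<noteq> 1"
  proof
    assume "n = 1"
    then have "y \<sim> v (i + 1)" using yn s_odd[of 0] by simp
    then show False by (simp add: yadj)
  qed
  ultimately have n2: "2 \<le> n" by simp
  have cases: "m = 0 \<or> (\<exists>t. m = 2 * Suc t \<and> int t \<le> k - 3) \<or> (\<exists>t. m = Suc (2 * t) \<and> int t \<le> k - 2)"
    if "m \<le> N" for m
  proof (cases "even m")
    case True
    then obtain t where "m = 2 * t" by (auto elim!: evenE)
    then show ?thesis using that k4 by (cases t) (auto simp: N_def)
  next
    case False then show ?thesis using that k4 by (auto elim!: oddE simp: N_def)
  qed
  show False
  proof (rule no_walk_around_edge[of n "v i" y s])
    show "2 \<le> n" by (rule n2)
    show "v i \<sim> y" using y adj_sym by blast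
    show "s m = s (Suc m) \<or> s m \<sim> s (Suc m)" for m
    proof (cases "even m")
      case True
      then obtain t where t: "m = 2 * t" by (auto elim!: evenE)
      show ?thesis
      proof (cases t)
        case 0
        then show ?thesis using t z(2) s0 s_odd[of 0] by simp
      next
        case (Suc u)
        then have m: "m = 2 * Suc u" "Suc m = Suc (2 * Suc u)" using t by auto
        show ?thesis unfolding m(2) s_odd unfolding m(1) s_even
          using conn(2)[of "i + 1 + int u"] by (simp add: algebra_simps)
      qed
    next
      case False
      then obtain t where t: "m = Suc (2 * t)" by (auto elim!: oddE)
      then have m: "Suc m = 2 * Suc t" by simp
      show ?thesis unfolding m s_even unfolding t s_odd
        using conn(1)[of "i + 1 + int t"] adj_sym by blast
    qed
    show "v i \<sim> s m \<longleftrightarrow> m = 0" if "m \<le> n" for m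
    proof -
      have "\<not> v i \<sim> conn (i + 1 + int t)" if "int t \<le> k - 3" for t
      proof
        assume "v i \<sim> conn (i + 1 + int t)"
        moreover have "i - (i + 1 + int t) = - int t - 1" "i - (i + 1 + int t + 1) = - int t - 2"
          by simp_all
        ultimately have "k dvd - int t - 1 \<or> k dvd - int t - 2"
          using conn_adj_iff[of "i + 1 + int t" i] adj_sym by metis
        then show False
          using dvd_small[of "- int t - 1"] dvd_small[of "- int t - 2"] that by auto
      qed
      then show ?thesis
        using cases[of m] that nN z(1) adj_sym v_not_adjacent by (auto simp: s0 s_even s_odd simp del: mult_Suc_right)
    qed
    show "y \<sim> s m \<longleftrightarrow> m = n" if "m \<le> n" for m
      using least[of m] yn that by (cases "m = n") auto
  qed
qed

lemma conn_adjacent: "conn (i - 1) \<sim> conn i"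
  by (rule connectors_adjacent[of _ i]) (use conn[of "i - 1"] conn[of i] in auto)

end

subsection \<open>Efficient domination\<close>

text \<open>Translates the arcs of \<open>cycle_graph\<close>, indexed by naturals, into the integer
  divisibility used for cyclic indices.\<close>

lemma eq_Suc_mod_iff_dvd:
  assumes "i < n" "j < n"
  shows "j = Suc i mod n \<longleftrightarrow> int n dvd int i - int j + 1"
proof -
  have "j = Suc i mod n \<longleftrightarrow> int j mod int n = int (Suc i) mod int n"
    using assms by (metis mod_less of_nat_eq_iff zmod_int)
  then show ?thesis
    by (simp add: mod_eq_dvd_iff dvd_diff_commute algebra_simps)
qed

locale efficient_square_cycle = square_cycle +
  fixes D :: "'a set"
  assumes no_P6: "\<lbrakk>a \<sim> b; b \<sim> c; c \<sim> d; d \<sim> e; e \<sim> f; \<not> a \<sim> c; \<not> a \<sim> d; \<not> a \<sim> e; \<not> a \<sim> f;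
      \<not> b \<sim> d; \<not> b \<sim> e; \<not> b \<sim> f; \<not> c \<sim> e; \<not> c \<sim> f; \<not> d \<sim> f\<rbrakk> \<Longrightarrow> False"
    and dominated: "\<exists>d\<in>D. d = v i \<or> d \<sim> v i"
    and dominator_unique: "\<lbrakk>d \<in> D; d' \<in> D; d = u \<or> d \<sim> u; d' = u \<or> d' \<sim> u\<rbrakk> \<Longrightarrow> d = d'"
begin

lemma D_not_adjacent: "d \<in> D \<Longrightarrow> d' \<in> D \<Longrightarrow> \<not> d \<sim> d'"
  using dominator_unique[of d d' d'] adj_irrefl by blast

text \<open>The connectors \<open>y\<close> and \<open>z\<close> on both sides are adjacent to
  \<open>d\<close>, so \<open>d\<close> is their only dominator. The dominators \<open>p\<close> and
  \<open>q\<close> of the next cycle vertices therefore avoid \<open>y\<close> and \<open>z\<close>,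
  and a \<open>P\<^sub>6\<close> appears.\<close>

lemma D_not_connector:
  assumes d: "d \<in> D" "d \<sim> v i" "d \<sim> v (i + 1)"
  shows False
proof -
  define y z where "y = conn (i - 1)" and "z = conn (i + 1)"
  have y: "y \<sim> v (i - 1)" "y \<sim> v i" "\<not> y \<sim> v (i + 2)"
    using conn_adj_iff[of "i - 1"] by (simp_all add: y_def)
  have z: "z \<sim> v (i + 1)" "z \<sim> v (i + 2)" "\<not> z \<sim> v (i - 1)"
    using conn_adj_iff[of "i + 1"] by (simp_all add: z_def)
  have yd: "y \<sim> d" using connectors_adjacent[of y i d] y d by blast
  have dz: "d \<sim> z" using connectors_adjacent[of d "i + 1" z] z d by (simp add: add.assoc)
  have dv: "\<not> d \<sim> v (i + 2)" "\<not> d \<sim> v (i - 1)"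
    using connector_adj_iff[OF d(2,3), of "i + 2"] connector_adj_iff[OF d(2,3), of "i - 1"] by auto
  obtain p where p: "p \<in> D" "p = v (i + 2) \<or> p \<sim> v (i + 2)" using dominated by blast
  obtain q where q: "q \<in> D" "q = v (i - 1) \<or> q \<sim> v (i - 1)" using dominated by blast
  have only_d: "r = d" if "r \<in> D" "r = y \<or> r \<sim> y \<or> r = z \<or> r \<sim> z" for r
    using dominator_unique[of r d y] dominator_unique[of r d z] that d(1) yd dz adj_sym by blast
  have far: "d \<noteq> v (i + 2)" "d \<noteq> v (i - 1)" using d(2) v_not_adjacent by auto
  have pd: "p \<noteq> d" and qd: "q \<noteq> d" using p(2) q(2) dv far by auto
  have pv: "p \<sim> v (i + 2)" using p only_d[of p] z(2) pd adj_sym by blast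
  have qv: "q \<sim> v (i - 1)" using q only_d[of q] y(1) qd adj_sym by blast
  \<comment> \<open>A common neighbour forces \<open>k\<close> to divide 4; then \<open>r\<close>
    connects \<open>v (i + 2)\<close> and \<open>v (i + 3)\<close>, so it is adjacent to
    \<open>z\<close> and must be \<open>d\<close>.\<close>
  have excl: "\<not> (r \<sim> v (i - 1) \<and> r \<sim> v (i + 2))" if r: "r \<in> D" for r
  proof
    assume h: "r \<sim> v (i - 1) \<and> r \<sim> v (i + 2)"
    have "k dvd 4" using dvd_common_neighbour[of r "i + 2" "i - 1"] h by simp
    then have "v (i + 3) = v (i - 1)" using v_eq_iff[of "i + 3" "i - 1"] by simp
    moreover have "i + 2 - 1 = i + 1" "i + 2 + 1 = i + 3" by simp_all
    ultimately have "z \<sim> r" using connectors_adjacent[of z "i + 2" r] z h by metis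
    then have "r = d" using only_d r adj_sym by blast
    then show False using h dv by blast
  qed
  have pq: "\<not> p \<sim> q" using D_not_adjacent p q by blast
  have nadj: "\<not> p \<sim> z" "\<not> p \<sim> y" "\<not> q \<sim> z" "\<not> q \<sim> y" using only_d p q pd qd by blast+
  have pd': "\<not> p \<sim> d" using D_not_adjacent p d by blast
  show False
  \<comment> \<open>If \<open>z\<close> and \<open>y\<close> are adjacent, the path runs from
    \<open>p\<close> to \<open>q\<close> through them; otherwise it passes through \<open>d\<close>
    and stops at \<open>v (i - 1)\<close>.\<close>
  proof (cases "z \<sim> y")
    case True
    show False
      by (rule no_P6[of p "v (i + 2)" z y "v (i - 1)" q])
        (use True pv qv z y nadj pq excl p q v_not_adjacent adj_sym in blast)+
  next
    case False
    show False
      by (rule no_P6[of p "v (i + 2)" z d y "v (i - 1)"])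
        (use False pv z y yd dz dv nadj pd' excl p v_not_adjacent adj_sym in blast)+
  qed
qed

text \<open>\<open>v i\<close> would be the only dominator of both adjacent connectors, so the
  dominators of \<open>v (i + 1)\<close> and \<open>v (i - 1)\<close> are the ends of a
  \<open>P\<^sub>6\<close> through them.\<close>

lemma v_notin_D: "v i \<notin> D"
proof
  assume d: "v i \<in> D"
  define y z where "y = conn (i - 1)" and "z = conn i"
  have y: "y \<sim> v (i - 1)" "y \<sim> v i" "\<not> y \<sim> v (i + 1)"
    using conn_adj_iff[of "i - 1"] by (simp_all add: y_def)
  have z: "z \<sim> v i" "z \<sim> v (i + 1)" "\<not> z \<sim> v (i - 1)"
    using conn_adj_iff[of i] by (simp_all add: z_def)
  have zy: "z \<sim> y" using conn_adjacent[of i] adj_sym by (simp add: y_def z_def)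
  obtain p where p: "p \<in> D" "p = v (i + 1) \<or> p \<sim> v (i + 1)" using dominated by blast
  obtain q where q: "q \<in> D" "q = v (i - 1) \<or> q \<sim> v (i - 1)" using dominated by blast
  have only: "r = v i" if "r \<in> D" "r = y \<or> r \<sim> y \<or> r = z \<or> r \<sim> z" for r
    using dominator_unique[of r "v i" y] dominator_unique[of r "v i" z] that d y z adj_sym by blast
  have ne: "v i \<noteq> v (i + 1)" "v i \<noteq> v (i - 1)" using v_eq_iff by auto
  have pd: "p \<noteq> v i" and qd: "q \<noteq> v i" using p(2) q(2) ne v_not_adjacent by auto
  have pv: "p \<sim> v (i + 1)" using p only[of p] z(2) pd adj_sym by blast
  have qv: "q \<sim> v (i - 1)" using q only[of q] y(1) qd adj_sym by blast
  have excl: "\<not> (r \<sim> v (i + 1) \<and> r \<sim> v (i - 1))" for r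
    using dvd_common_neighbour[of r "i + 1" "i - 1"] by auto
  have pq: "\<not> p \<sim> q" using D_not_adjacent p q by blast
  have nadj: "\<not> p \<sim> z" "\<not> p \<sim> y" "\<not> q \<sim> z" "\<not> q \<sim> y" using only p q pd qd by blast+
  show False
    by (rule no_P6[of p "v (i + 1)" z y "v (i - 1)" q])
      (use zy pv qv z y nadj pq excl p q v_not_adjacent adj_sym in blast)+
qed

section \<open>Private dominators and the connectors they dominate\<close>

definition dominator :: "int \<Rightarrow> 'a" where
  "dominator i = (SOME d. d \<in> D \<and> d \<sim> v i)"

lemma dominator: "dominator i \<in> D" "dominator i \<sim> v i"
  using someI_ex[of "\<lambda>d. d \<in> D \<and> d \<sim> v i"] dominated[of i] v_notin_D[of i]
  unfolding dominator_def by auto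

lemma dominator_cong: "k dvd i - j \<Longrightarrow> dominator i = dominator j"
  using v_eq_iff[of i j] by (simp add: dominator_def)

text \<open>A second cycle vertex with the same dominator would be consecutive to
  \<open>v i\<close>, making the dominator a connector.\<close>

lemma dominator_adj_v_iff: "dominator i \<sim> v j \<longleftrightarrow> k dvd i - j"
proof
  assume h: "dominator i \<sim> v j"
  show "k dvd i - j"
  proof (rule ccontr)
    assume "\<not> k dvd i - j"
    from dvd_common_neighbour[OF dominator(2) h this] show False
    proof
      assume "k dvd i - j - 1"
      then have "v i = v (j + 1)" using v_eq_iff[of i "j + 1"] by (simp add: algebra_simps)
      then show False using D_not_connector[OF dominator(1) h] dominator(2)[of i] by simp
    next
      assume "k dvd i - j + 1"
      then have "v j = v (i + 1)" using v_eq_iff[of "i + 1" j] by (simp add: algebra_simps)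
      then show False using D_not_connector[OF dominator(1) dominator(2)] h by simp
    qed
  qed
next
  assume "k dvd i - j"
  then show "dominator i \<sim> v j" using dominator[of i] v_eq_iff[of i j] by simp
qed

text \<open>A connector has only one dominator, and distinct cycle vertices have distinct
  dominators.\<close>

lemma dominator_common_conn:
  assumes "dominator i \<sim> conn m" "dominator j \<sim> conn m"
  shows "k dvd i - j"
proof -
  have "dominator i = dominator j" using dominator_unique[of "dominator i" "dominator j" "conn m"] assms dominator by blast
  then show ?thesis using dominator(2)[of j] dominator_adj_v_iff[of i j] by simp
qed

text \<open>Otherwise \<open>conn i\<close>, \<open>conn (i + 1)\<close>,
  \<open>dominator i\<close>, \<open>v i\<close> form a four-cycle with roof
  \<open>v (i + 1)\<close>, a house.\<close>

lemma dominator_adj_conn_succ: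
  assumes "dominator i \<sim> conn (i + 1)"
  shows "dominator i \<sim> conn i"
proof (rule ccontr)
  assume no: "\<not> dominator i \<sim> conn i"
  have "conn i \<sim> conn (i + 1)" using conn_adjacent[of "i + 1"] by simp
  moreover have "\<not> v (i + 1) \<sim> dominator i" using dominator_adj_v_iff[of i "i + 1"] adj_sym by auto
  moreover have "\<not> conn (i + 1) \<sim> v i" by (simp add: conn_adj_iff)
  ultimately show False
    using no_house[of "conn i" "conn (i + 1)" "dominator i" "v i" "v (i + 1)"] assms no
      conn[of i] conn(1)[of "i + 1"] dominator(2)[of i] v_not_adjacent adj_sym by blast
qed

text \<open>Mirror image of \<open>dominator_adj_conn_succ\<close>, with roof
  \<open>v (i - 1)\<close>.\<close>

lemma dominator_adj_conn_pred:
  assumes "dominator i \<sim> conn (i - 2)"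
  shows "dominator i \<sim> conn (i - 1)"
proof (rule ccontr)
  assume no: "\<not> dominator i \<sim> conn (i - 1)"
  have "conn (i - 2) \<sim> conn (i - 1)" using conn_adjacent[of "i - 1"] by simp
  moreover have "\<not> v (i - 1) \<sim> dominator i" using dominator_adj_v_iff[of i "i - 1"] adj_sym by auto
  moreover have "\<not> conn (i - 2) \<sim> v i" "conn (i - 2) \<sim> v (i - 1)" "conn (i - 1) \<sim> v (i - 1)"
      "conn (i - 1) \<sim> v i"
    by (simp_all add: conn_adj_iff)
  ultimately show False
    using no_house[of "conn (i - 1)" "conn (i - 2)" "dominator i" "v i" "v (i - 1)"] assms no
      dominator(2)[of i] v_not_adjacent adj_sym by blast
qed

text \<open>If both fail, the two preceding lemmas also exclude the farther connectors, leaving a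
  \<open>P\<^sub>6\<close> from \<open>dominator i\<close> to
  \<open>dominator (i + 2)\<close>.\<close>

lemma dominator_adj_conn_cases: "dominator i \<sim> conn i \<or> dominator (i + 2) \<sim> conn (i + 1)"
proof (rule ccontr)
  assume no: "\<not> (dominator i \<sim> conn i \<or> dominator (i + 2) \<sim> conn (i + 1))"
  have "\<not> dominator i \<sim> conn (i + 1)" using no dominator_adj_conn_succ by blast
  moreover have "\<not> dominator (i + 2) \<sim> conn i" using no dominator_adj_conn_pred[of "i + 2"] by (auto simp: add.commute)
  moreover have "conn i \<sim> conn (i + 1)" using conn_adjacent[of "i + 1"] by simp
  moreover have "conn (i + 1) \<sim> v (i + 2)" "\<not> conn (i + 1) \<sim> v i" "\<not> conn i \<sim> v (i + 2)"
      "\<not> dominator i \<sim> v (i + 2)" "\<not> dominator (i + 2) \<sim> v i"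
    by (simp_all add: conn_adj_iff dominator_adj_v_iff)
  moreover have "\<not> dominator i \<sim> dominator (i + 2)" using D_not_adjacent dominator by blast
  ultimately show False
    using no_P6[of "dominator i" "v i" "conn i" "conn (i + 1)" "v (i + 2)" "dominator (i + 2)"] no
      conn(1)[of i] dominator(2)[of i] dominator(2)[of "i + 2"] v_not_adjacent adj_sym by blast
qed

lemma dominator_adj_conn_offset:
  obtains e where "e = 0 \<or> e = 1" "\<And>i. dominator (i + e) \<sim> conn i"
proof (cases "\<exists>i. dominator i \<sim> conn i")
  case True
  then obtain i where i: "dominator i \<sim> conn i" by blast
  \<comment> \<open>The other alternative at \<open>j - 1\<close> would give \<open>conn j\<close> a
    second dominator.\<close>
  have prev: "dominator (j - 1) \<sim> conn (j - 1)" if "dominator j \<sim> conn j" for j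
    using dominator_adj_conn_cases[of "j - 1"] dominator_common_conn[of "j + 1" j j] that
    by (auto simp: add.commute)
  have "dominator (i - int n) \<sim> conn (i - int n)" for n
  proof (induction n)
    case (Suc n)
    then show ?case using prev[of "i - int n"] by (simp add: diff_diff_eq add.commute)
  qed (use i in simp)
  \<comment> \<open>Descending from \<open>i\<close> by \<open>(i - j) mod k\<close> steps reaches
    an index congruent to \<open>j\<close>.\<close>
  moreover have "k dvd (i - int (nat ((i - j) mod k))) - j" for j
  proof -
    have "(i - int (nat ((i - j) mod k))) - j = (i - j) - (i - j) mod k"
      using k4 by simp
    then show ?thesis by (simp add: minus_mod_eq_mult_div)
  qed
  ultimately have "dominator j \<sim> conn j" for j
    using dominator_cong conn_cong by metis
  then show ?thesis using that[of 0] by simp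
next
  case False
  then have "dominator (i + 1) \<sim> conn i" for i using dominator_adj_conn_cases[of "i - 1"] by (simp add: algebra_simps)
  then show ?thesis using that[of 1] by simp
qed

text \<open>The connectors form a chordless cycle of length \<open>k\<close>: a hole if
  \<open>k\<close> is at least 5, and the base of a house if \<open>k = 4\<close>.\<close>

lemma no_efficient_dominating_set: False
proof -
  obtain e where e: "e = 0 \<or> e = 1" and off: "\<And>i. dominator (i + e) \<sim> conn i"
    using dominator_adj_conn_offset by metis
  have dominator_conn: "dominator i \<sim> conn j \<Longrightarrow> k dvd i - (j + e)" for i j
    using dominator_common_conn off by blast
  have adj: "conn a \<sim> conn b \<longleftrightarrow> k dvd a - b - 1 \<or> k dvd a - b + 1" for a b
  proof
    assume "k dvd a - b - 1 \<or> k dvd a - b + 1"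
    then have "conn a = conn (b + 1) \<or> conn b = conn (a + 1)"
      using conn_cong[of a "b + 1"] conn_cong[of "a + 1" b] by (auto simp: algebra_simps)
    then show "conn a \<sim> conn b"
      using conn_adjacent[of "a + 1"] conn_adjacent[of "b + 1"] adj_sym by auto
  next
    assume ab: "conn a \<sim> conn b"
    have neq: "\<not> k dvd a - b" using conn_cong[of a b] ab adj_irrefl by auto
    show "k dvd a - b - 1 \<or> k dvd a - b + 1"
    proof (rule ccontr)
      assume no: "\<not> (k dvd a - b - 1 \<or> k dvd a - b + 1)"
      then have no': "\<not> k dvd b - a - 1" "\<not> k dvd b - a + 1" "\<not> k dvd b - a"
        using neq by (simp_all add: dvd_diff_commute algebra_simps)
      \<comment> \<open>Of the two cycle neighbours of \<open>conn a\<close>, \<open>v s\<close> is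
        the one whose dominator does not dominate \<open>conn a\<close>; likewise \<open>v t\<close>
        for \<open>conn b\<close>. A chord then joins two such arms into a
        \<open>P\<^sub>6\<close>.\<close>
      define s t where "s = a + 1 - e" and "t = b + 1 - e"
      have "\<not> dominator s \<sim> conn a" "\<not> dominator s \<sim> conn b" "\<not> dominator t \<sim> conn a" "\<not> dominator t \<sim> conn b"
        using dominator_conn[of s a] dominator_conn[of s b] dominator_conn[of t a] dominator_conn[of t b] e no no'
        by (auto simp: s_def t_def algebra_simps)
      moreover have "conn a \<sim> v s" "conn b \<sim> v t" "\<not> conn a \<sim> v t" "\<not> conn b \<sim> v s"
        using e no no' neq by (auto simp: conn_adj_iff s_def t_def algebra_simps)
      moreover have "\<not> dominator s \<sim> v t" "\<not> dominator t \<sim> v s"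
        using neq no' by (auto simp: dominator_adj_v_iff s_def t_def)
      moreover have "\<not> dominator s \<sim> dominator t" using D_not_adjacent dominator by blast
      ultimately show False
        using no_P6[of "dominator s" "v s" "conn a" "conn b" "v t" "dominator t"] ab
          dominator(2)[of s] dominator(2)[of t] v_not_adjacent adj_sym by blast
    qed
  qed
  show False
  proof (cases "k = 4")
    case True
    show False
      by (rule no_house[of "conn 0" "conn 1" "conn 2" "conn 3" "v 1"])
        (use True conn_adj_iff[of 0 1] conn_adj_iff[of 1 1] conn_adj_iff[of 2 1] conn_adj_iff[of 3 1]
          in \<open>auto simp: adj intro: adj_sym dest: adj_sym\<close>)
  next
    case False
    show False
    proof (rule no_hole[of "nat k" "\<lambda>i. conn (int i)"])
      show "5 \<le> nat k" using False k4 by simp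
      fix i j assume "i < nat k" "j < nat k"
      then have "j = Suc i mod nat k \<longleftrightarrow> k dvd int i - int j + 1"
        "i = Suc j mod nat k \<longleftrightarrow> k dvd int j - int i + 1"
        using eq_Suc_mod_iff_dvd[of i "nat k" j] eq_Suc_mod_iff_dvd[of j "nat k" i] k4 by simp_all
      moreover have "k dvd int j - int i + 1 \<longleftrightarrow> k dvd int i - int j - 1"
        using dvd_minus_iff[of k "int i - int j - 1"] by (simp add: algebra_simps)
      ultimately show "conn (int i) \<sim> conn (int j) \<longleftrightarrow> j = Suc i mod nat k \<or> i = Suc j mod nat k"
        using adj by auto
    qed
  qed
qed

end

subsection \<open>Forbidden subgraphs as adjacency patterns\<close>

lemma induced_free_listD:
  assumes "induced_free F G" "pair_wf_digraph F" "pair_wf_digraph G"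
    and len: "pverts F = {..<length xs}" and xs: "distinct xs" "set xs \<subseteq> pverts G"
    and arcs: "\<forall>i<length xs. \<forall>j<length xs. (xs ! i, xs ! j) \<in> parcs G \<longleftrightarrow> (i, j) \<in> parcs F"
  shows False
proof -
  have "inj_on ((!) xs) (pverts F)" using xs(1) len by (auto intro: inj_on_nth)
  moreover have "(!) xs ` pverts F \<subseteq> pverts G" using xs(2) len by auto
  ultimately show False
    using not_induced_freeI[of F G "(!) xs"] assms by auto
qed

lemma induced_P6_freeD:
  assumes G: "pair_graph G" and free: "induced_free (path_graph 6) G"
    and adj: "(a, b) \<in> parcs G" "(b, c) \<in> parcs G" "(c, d) \<in> parcs G" "(d, e) \<in> parcs G" "(e, f) \<in> parcs G"
    and nadj: "(a, c) \<notin> parcs G" "(a, d) \<notin> parcs G" "(a, e) \<notin> parcs G" "(a, f) \<notin> parcs G"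
      "(b, d) \<notin> parcs G" "(b, e) \<notin> parcs G" "(b, f) \<notin> parcs G"
      "(c, e) \<notin> parcs G" "(c, f) \<notin> parcs G" "(d, f) \<notin> parcs G"
  shows False
proof -
  interpret G: pair_graph G by (rule G)
  have sym: "(x, y) \<in> parcs G \<longleftrightarrow> (y, x) \<in> parcs G" for x y
    using G.pair_sym_arcs by (auto simp: symmetric_def dest: symD)
  have nsym: "(x, y) \<notin> parcs G \<Longrightarrow> (y, x) \<notin> parcs G" for x y
    using sym by blast
  have irr: "(x, x) \<notin> parcs G" for x
    using G.no_loops' by auto
  note adj' = adj adj[THEN sym[THEN iffD1]]
  note nadj' = nadj nadj[THEN nsym]
  have "distinct [a, b, c, d, e, f]"
    using adj' nadj' irr by auto
  moreover have "set [a, b, c, d, e, f] \<subseteq> pverts G"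
    using adj G.wellformed' by auto
  ultimately show False
    using adj' nadj' irr
    by (intro induced_free_listD[OF free pair_wf_digraph_path_graph G.pair_wf_digraph, of "[a, b, c, d, e, f]"])
      (auto simp: path_graph_def All_less_Suc numeral_eq_Suc)
qed

lemma hhd_free_adjacencyI:
  assumes G: "pair_graph G" and free: "HHD_free G"
  shows "hhd_free_adjacency (\<lambda>u w. (u, w) \<in> parcs G)"
proof -
  interpret G: pair_graph G by (rule G)
  note wf = G.pair_wf_digraph
  have sym: "(x, y) \<in> parcs G \<longleftrightarrow> (y, x) \<in> parcs G" for x y
    using G.pair_sym_arcs by (auto simp: symmetric_def dest: symD)
  have nsym: "(x, y) \<notin> parcs G \<Longrightarrow> (y, x) \<notin> parcs G" for x y
    using sym by blast
  have irr: "(x, x) \<notin> parcs G" for x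
    using G.no_loops' by auto
  show ?thesis
  proof
    show "(b, a) \<in> parcs G" if "(a, b) \<in> parcs G" for a b using that sym by blast
    show "(a, a) \<notin> parcs G" for a by (rule irr)
    show False if h: "(a, b) \<in> parcs G" "(b, c) \<in> parcs G" "(c, d) \<in> parcs G" "(d, a) \<in> parcs G"
      "(r, a) \<in> parcs G" "(r, b) \<in> parcs G" and
      nh: "(a, c) \<notin> parcs G" "(b, d) \<notin> parcs G" "(r, c) \<notin> parcs G" "(r, d) \<notin> parcs G" for a b c d r
    proof -
      note h' = h h[THEN sym[THEN iffD1]]
      note nh' = nh nh[THEN nsym]
      \<comment> \<open>The house is the complement of \<open>P\<^sub>5\<close>, so successive list
        entries are the nonadjacent pairs.\<close>
      have "distinct [a, c, r, d, b]"
        using h' nh' irr by auto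
      moreover have "set [a, c, r, d, b] \<subseteq> pverts G"
        using h G.wellformed' by auto
      moreover have "induced_free house G" using free by (simp add: HHD_free_def)
      ultimately show False
        using h' nh' irr
        by (intro induced_free_listD[OF _ pair_wf_digraph_house wf, of "[a, c, r, d, b]"])
          (auto simp: house_def complement_graph_def path_graph_def All_less_Suc numeral_eq_Suc)
    qed
    show False if h: "(a, b) \<in> parcs G" "(b, c) \<in> parcs G" "(c, d) \<in> parcs G" "(d, a) \<in> parcs G"
      "(c, e) \<in> parcs G" "(e, f) \<in> parcs G" "(f, d) \<in> parcs G" and
      nh: "(a, c) \<notin> parcs G" "(b, d) \<notin> parcs G" "(c, f) \<notin> parcs G" "(e, d) \<notin> parcs G"
      "(a, e) \<notin> parcs G" "(a, f) \<notin> parcs G" "(b, e) \<notin> parcs G" "(b, f) \<notin> parcs G" for a b c d e f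
    proof -
      note h' = h h[THEN sym[THEN iffD1]]
      note nh' = nh nh[THEN nsym]
      \<comment> \<open>The first five entries are the path, and \<open>d\<close> is the extra
        vertex next to \<open>a\<close>, \<open>c\<close> and \<open>f\<close>.\<close>
      have "distinct [a, b, c, e, f, d]"
        using h' nh' irr by auto
      moreover have "set [a, b, c, e, f, d] \<subseteq> pverts G"
        using h G.wellformed' by auto
      moreover have "induced_free domino G" using free by (simp add: HHD_free_def)
      ultimately show False
        using h' nh' irr
        by (intro induced_free_listD[OF _ pair_wf_digraph_domino wf, of "[a, b, c, e, f, d]"])
          (auto simp: domino_def path_graph_def All_less_Suc numeral_eq_Suc)
    qed
    show False if n: "5 \<le> n" and
      g: "\<And>i j. i < n \<Longrightarrow> j < n \<Longrightarrow> (g i, g j) \<in> parcs G \<longleftrightarrow> j = Suc i mod n \<or> i = Suc j mod n"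
      for n and g :: "nat \<Rightarrow> 'a"
    proof -
      have inj: "inj_on g {..<n}"
      proof (rule inj_onI; rule ccontr)
        fix i j assume ij: "i \<in> {..<n}" "j \<in> {..<n}" "g i = g j" "i \<noteq> j"
        \<comment> \<open>If \<open>g x = g y\<close>, the successor of \<open>x\<close> is also an
          index neighbour of \<open>y\<close>, so it must be the predecessor of \<open>y\<close>
          modulo \<open>n\<close>. Exchanging the roles and adding makes \<open>n\<close> divide
          4.\<close>
        have nbr: "int n dvd int y - int x - 2" if "x < n" "y < n" "g x = g y" "x \<noteq> y" for x y
        proof -
          define m where "m = Suc x mod n"
          have m: "m < n" using n by (simp add: m_def)
          have d: "int n dvd int x - int m + 1"
            using eq_Suc_mod_iff_dvd[of x n m] that m by (simp add: m_def)
          have "(g y, g m) \<in> parcs G" using g[of x m] that m by (simp add: m_def)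
          then have "int n dvd int y - int m + 1 \<or> int n dvd int m - int y + 1"
            using g[of y m] eq_Suc_mod_iff_dvd[of y n m] eq_Suc_mod_iff_dvd[of m n y] that m by auto
          moreover have "\<not> int n dvd int y - int m + 1"
          proof
            assume "int n dvd int y - int m + 1"
            from dvd_diff[OF this d] have "int n dvd int y - int x" by (simp add: algebra_simps)
            then have "int y mod int n = int x mod int n" by (simp add: mod_eq_dvd_iff)
            then show False using that by simp
          qed
          ultimately have "int n dvd (int x - int m + 1) + (int m - int y + 1)"
            using dvd_add d by blast
          then have "int n dvd - (int y - int x - 2)" by (simp add: algebra_simps)
          then show ?thesis by (simp only: dvd_minus_iff)
        qed
        have "int n dvd (int j - int i - 2) + (int i - int j - 2)"
          using nbr[of i j] nbr[of j i] ij by (intro dvd_add) auto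
        then have "int n dvd 4" by simp
        then show False using n zdvd_imp_le[of "int n" 4] by simp
      qed
      have "induced_free (cycle_graph n) G" using free n by (simp add: HHD_free_def)
      moreover have "\<not> induced_free (cycle_graph n) G"
      proof (rule not_induced_freeI[OF pair_wf_digraph_cycle_graph wf])
        show "inj_on g (pverts (cycle_graph n))" using inj by (simp add: cycle_graph_def)
        show "g ` pverts (cycle_graph n) \<subseteq> pverts G"
        proof
          fix w assume "w \<in> g ` pverts (cycle_graph n)"
          then obtain i where i: "i < n" "w = g i" by (auto simp: cycle_graph_def)
          then have "(g i, g (Suc i mod n)) \<in> parcs G" using g[of i "Suc i mod n"] n by simp
          then show "w \<in> pverts G" using i G.wellformed' by auto
        qed
      qed (use g in \<open>auto simp: cycle_graph_def\<close>)
      ultimately show False by simp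
    qed
  qed
qed

section \<open>Transfer from an induced cycle of the square to integer indices\<close>

theorem theorem1:
  fixes G :: "'a pair_pre_digraph"
  assumes "pair_graph G"
    and "induced_free (path_graph 6) G"
    and "HHD_free G"
    and "\<exists>D. efficient_dominating_set G D"
  shows "chordal (square_graph G)"
proof (rule ccontr)
  interpret G: pair_graph G by (rule assms)
  have G: "pair_wf_digraph G" by unfold_locales
  define A where "A u w \<longleftrightarrow> (u, w) \<in> parcs G" for u w
  have sym: "A a b \<Longrightarrow> A b a" for a b
    using G.pair_sym_arcs by (auto simp: A_def symmetric_def dest: symD)
  have irr: "\<not> A a a" for a
    using G.no_loops' by (auto simp: A_def)
  have verts: "a \<in> pverts G" "b \<in> pverts G" if "A a b" for a b
    using that G.wellformed' by (auto simp: A_def)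
  assume "\<not> chordal (square_graph G)"
  then obtain n where n: "4 \<le> n" "\<not> induced_free (cycle_graph n) (square_graph G)"
    by (auto simp: chordal_def)
  obtain f where f: "inj_on f (pverts (cycle_graph n))"
      "f ` pverts (cycle_graph n) \<subseteq> pverts (square_graph G)"
      "\<And>i j. i \<in> pverts (cycle_graph n) \<Longrightarrow> j \<in> pverts (cycle_graph n) \<Longrightarrow>
        (f i, f j) \<in> parcs (square_graph G) \<longleftrightarrow> (i, j) \<in> parcs (cycle_graph n)"
    using not_induced_freeE[OF n(2)] by metis
  \<comment> \<open>Extends the embedding periodically from the residues below \<open>n\<close> to
    all integers.\<close>
  define v where "v i = f (nat (i mod int n))" for i
  have res: "nat (i mod int n) < n" "int (nat (i mod int n)) = i mod int n" for i
    using n(1) by (auto simp: nat_less_iff)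
  have vV: "v i \<in> pverts G" for i
    using f(2) res[of i] by (auto simp: v_def cycle_graph_def square_graph_def)
  have v_eq: "v i = v j \<longleftrightarrow> int n dvd i - j" for i j
  proof -
    have "v i = v j \<longleftrightarrow> nat (i mod int n) = nat (j mod int n)"
      using inj_on_eq_iff[OF f(1)] res by (auto simp: v_def cycle_graph_def)
    also have "\<dots> \<longleftrightarrow> i mod int n = j mod int n"
      using res(2) by metis
    finally show ?thesis by (simp add: mod_eq_dvd_iff)
  qed
  have sq: "A (v i) (v j) \<or> (\<exists>x. A (v i) x \<and> A x (v j)) \<longleftrightarrow> int n dvd i - j - 1 \<or> int n dvd i - j + 1"
    if "v i \<noteq> v j" for i j
  proof -
    let ?a = "nat (i mod int n)" and ?b = "nat (j mod int n)"
    have "A (v i) (v j) \<or> (\<exists>x. A (v i) x \<and> A x (v j)) \<longleftrightarrow> (v i, v j) \<in> parcs (square_graph G)"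
      using that vV graph_dist_1_2_iff[OF assms(1), of "v i" "v j"]
      by (simp add: square_graph_def A_def)
    also have "\<dots> \<longleftrightarrow> ?b = Suc ?a mod n \<or> ?a = Suc ?b mod n"
      using f(3)[of ?a ?b] res[of i] res[of j] by (simp add: v_def cycle_graph_def)
    also have "\<dots> \<longleftrightarrow> int n dvd i mod int n - j mod int n + 1 \<or> int n dvd j mod int n - i mod int n + 1"
      using eq_Suc_mod_iff_dvd[of ?a n ?b] eq_Suc_mod_iff_dvd[of ?b n ?a] res by simp
    also have "\<dots> \<longleftrightarrow> int n dvd i - j + 1 \<or> int n dvd j - i + 1"
      unfolding dvd_eq_mod_eq_0 by (metis mod_add_left_eq mod_diff_eq)
    also have "int n dvd j - i + 1 \<longleftrightarrow> int n dvd i - j - 1"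
      using dvd_minus_iff[of "int n" "i - j - 1"] by (simp add: algebra_simps)
    finally show ?thesis by blast
  qed
  obtain D where D: "D \<subseteq> pverts G" "\<And>u. u \<in> pverts G \<Longrightarrow> \<exists>!d. d \<in> D \<and> vertex_dominates G d u"
    using assms(4) by (auto simp: efficient_dominating_set_def)
  have dominates: "vertex_dominates G d u \<longleftrightarrow> d = u \<or> A d u" for d u
    by (simp add: vertex_dominates_def A_def)
  interpret hhd_free_adjacency A
    unfolding A_def using hhd_free_adjacencyI assms(1,3) by blast
  interpret efficient_square_cycle A v "int n" D
  proof
    show "4 \<le> int n" using n(1) by simp
    show "v i = v j \<longleftrightarrow> int n dvd i - j" for i j by (rule v_eq)
    show "A (v i) (v j) \<or> (\<exists>x. A (v i) x \<and> A x (v j)) \<longleftrightarrow> int n dvd i - j - 1 \<or> int n dvd i - j + 1"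
      if "v i \<noteq> v j" for i j using that by (rule sq)
    show False if "A a b" "A b c" "A c d" "A d e" "A e f" "\<not> A a c" "\<not> A a d" "\<not> A a e" "\<not> A a f"
      "\<not> A b d" "\<not> A b e" "\<not> A b f" "\<not> A c e" "\<not> A c f" "\<not> A d f" for a b c d e f
      using induced_P6_freeD[OF assms(1,2)] that unfolding A_def by blast
    show "\<exists>d\<in>D. d = v i \<or> A d (v i)" for i
      using D(2)[OF vV[of i]] unfolding dominates by blast
    show "d = d'" if "d \<in> D" "d' \<in> D" "d = u \<or> A d u" "d' = u \<or> A d' u" for d d' u
    proof -
      \<comment> \<open>Here \<open>u\<close> is arbitrary: lying in \<open>D\<close> or next to a
        member of \<open>D\<close> makes it a vertex.\<close>
      have "u \<in> pverts G" using that D(1) verts by blast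
      from D(2)[OF this] show ?thesis using that unfolding dominates by blast
    qed
  qed
  show False by (rule no_efficient_dominating_set)
qed

end
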